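(* Suppose the deterministic Slater condition holds. Let $V$ be a positive integer, define $\alpha=V^2$, and run the online algorithm described in the context with these parameters. Then for each constraint $i\in\{1,\dots,k\}$ we have $$\frac{1}{T}\sum_{t=0}^{T-1}g_{t,i}(X_t)\le\frac{\theta V}{T}+\frac{G^2}{4V}+\frac{G^2(1+\theta\sqrt{k})^2}{4V}\qquad\text{for all integers } T>0.$$ Hence, constraint violations are $O(1/V)$ whenever $T\ge V^2$.
   Context: Setting. Fix positive integers $n,k$. $\mathcal{X}\subseteq\mathbb{R}^n$ is a convex compact set; $\|\cdot\|$ is the Euclidean norm; $D\ge 0$ is a constant with $\|x-y\|\le D$ for all $x,y\in\mathcal{X}$. $\{f_t\}_{t=0}^\infty$ and $\{g_{t,i}\}_{t=0}^\infty$ ($i\in\{1,\dots,k\}$) are sequences of continuous convex functions $\mathcal{X}\to\mathbb{R}$ (possibly nonsmooth). $F\ge 0$ is a constant with $|f_t(x)|\le F$ and $|g_{t,i}(x)|\le F$ for all $t$, $i$ and $x\in\mathcal{X}$. For every $x\in\mathcal{X}$ particular subgradients $f_t'(x)$, $g_{t,i}'(x)\in\mathbb{R}^n$ are fixed, i.e. $f_t(y)\ge f_t(x)+f_t'(x)^T(y-x)$ and $g_{t,i}(y)\ge g_{t,i}(x)+g_{t,i}'(x)^T(y-x)$ for all $y\in\mathcal{X}$, and $G>0$ is a constant with $\|f_t'(x)\|\le G$ and $\|g_{t,i}'(x)\|\le G$ for all $t$, $i$, $x$. Slater condition: there exist a real number $\eta>0$ and a vector $s\in\mathcal{X}$ (the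 Slater vector) such that $g_{t,i}(s)\le-\eta$ for all $t\in\{0,1,2,\dots\}$ and all $i\in\{1,\dots,k\}$. Algorithm with parameters $V>0$, $\alpha>0$. Fix $x_0\in\mathcal{X}$ and set $X_0=x_0$. Virtual queues satisfy $Q_i(0)=Q_i(1)=0$ and, for $t\in\{1,2,3,\dots\}$, $$Q_i(t+1)=\max\left[Q_i(t)+g_{t-1,i}(X_{t-1})+g_{t-1,i}'(X_{t-1})^T(X_t-X_{t-1}),\,0\right].$$ On each slot $t\in\{1,2,3,\dots\}$, $X_t$ is the (unique) minimizer over $x\in\mathcal{X}$ of $$\left[Vf_{t-1}'(X_{t-1})^T+\sum_{i=1}^kQ_i(t)g_{t-1,i}'(X_{t-1})^T\right]x+\alpha\|x-X_{t-1}\|^2.$$ Constants: $B=\frac{k(F+GD)^2}{2}$, $R=\frac{VG^2}{2\alpha}+2F$, $\delta=\sqrt{k}(F+DG)$, and $$\theta=\max\left[\delta,\ \frac{B+RV}{\eta V}+\frac{\alpha D^2}{\eta V(V+1)}+\frac{\delta(V+2)}{2V}\right].$$ $O(1/V)$ denotes a quantity at most $c/V$ for a constant $c$ not depending on $V$ or $T$. *)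

theory Defs
  imports "HOL-Analysis.Analysis"
begin

definition is_subgradient_on :: "'a::real_inner set \<Rightarrow> ('a \<Rightarrow> real) \<Rightarrow> 'a \<Rightarrow> 'a \<Rightarrow> bool" where
  "is_subgradient_on S f x v \<longleftrightarrow> (\<forall>y\<in>S. f y \<ge> f x + v \<bullet> (y - x))"

definition slater_vector ::
  "'a set \<Rightarrow> nat \<Rightarrow> (nat \<Rightarrow> nat \<Rightarrow> 'a \<Rightarrow> real) \<Rightarrow> real \<Rightarrow> 'a \<Rightarrow> bool" where
  "slater_vector \<X> k g \<eta> s \<longleftrightarrow> \<eta> > 0 \<and> s \<in> \<X> \<and> (\<forall>t. \<forall>i\<in>{1..k}. g t i s \<le> - \<eta>)"

text \<open>
  Time comes first and the constraint index, ranging over \<open>{1..k}\<close>, second: \<open>g t i\<close> is the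
  \<open>i\<close>-th constraint function of slot \<open>t\<close>, and \<open>f' t x\<close>, \<open>g' t i x\<close> are the chosen subgradients
  at \<open>x\<close>. \<open>online_run\<close> says that the decisions \<open>X t\<close> and the virtual queues \<open>Q i t\<close> are produced
  by the algorithm with real parameters \<open>V\<close> and \<open>\<alpha>\<close>. For \<open>\<alpha> > 0\<close> the objective is strongly
  convex, so on a nonempty compact convex \<open>\<X>\<close> the minimizer exists and is unique, and the run is
  determined by \<open>x0\<close> (up to the irrelevant \<open>Q i\<close> with \<open>i \<notin> {1..k}\<close>).
\<close>

definition online_run ::
  "'a::real_inner set \<Rightarrow> nat \<Rightarrow> (nat \<Rightarrow> 'a \<Rightarrow> 'a) \<Rightarrow> (nat \<Rightarrow> nat \<Rightarrow> 'a \<Rightarrow> real) \<Rightarrow>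
    (nat \<Rightarrow> nat \<Rightarrow> 'a \<Rightarrow> 'a) \<Rightarrow> real \<Rightarrow> real \<Rightarrow> 'a \<Rightarrow> (nat \<Rightarrow> 'a) \<Rightarrow> (nat \<Rightarrow> nat \<Rightarrow> real) \<Rightarrow> bool" where
  "online_run \<X> k f' g g' V \<alpha> x0 X Q \<longleftrightarrow>
     X 0 = x0 \<and>
     (\<forall>i\<in>{1..k}. Q i 0 = 0 \<and> Q i 1 = 0) \<and>
     (\<forall>i\<in>{1..k}. \<forall>t\<ge>1. Q i (t + 1) =
        max (Q i t + g (t - 1) i (X (t - 1)) + g' (t - 1) i (X (t - 1)) \<bullet> (X t - X (t - 1))) 0) \<and>
     (\<forall>t\<ge>1. is_arg_min
        (\<lambda>x. (V *\<^sub>R f' (t - 1) (X (t - 1)) + (\<Sum>i=1..k. Q i t *\<^sub>R g' (t - 1) i (X (t - 1)))) \<bullet> x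
              + \<alpha> * (norm (x - X (t - 1)))\<^sup>2)
        (\<lambda>x. x \<in> \<X>) (X t))"

definition B_const :: "nat \<Rightarrow> real \<Rightarrow> real \<Rightarrow> real \<Rightarrow> real" where
  "B_const k F G D = real k * (F + G * D)\<^sup>2 / 2"

definition R_const :: "real \<Rightarrow> real \<Rightarrow> real \<Rightarrow> real \<Rightarrow> real" where
  "R_const F G V \<alpha> = V * G\<^sup>2 / (2 * \<alpha>) + 2 * F"

definition delta_const :: "nat \<Rightarrow> real \<Rightarrow> real \<Rightarrow> real \<Rightarrow> real" where
  "delta_const k F G D = sqrt (real k) * (F + D * G)"

definition theta_const ::
  "nat \<Rightarrow> real \<Rightarrow> real \<Rightarrow> real \<Rightarrow> real \<Rightarrow> real \<Rightarrow> real \<Rightarrow> real" where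
  "theta_const k F G D \<eta> V \<alpha> =
     max (delta_const k F G D)
       ((B_const k F G D + R_const F G V \<alpha> * V) / (\<eta> * V)
        + \<alpha> * D\<^sup>2 / (\<eta> * V * (V + 1))
        + delta_const k F G D * (V + 2) / (2 * V))"

end

theory Submission
  imports Defs
begin

text \<open>
  Write \<open>\<parallel>Q(t)\<parallel>\<close> for the Euclidean norm of the queue vector. A queue grows in every slot by at least
  the linearised constraint value, so the sum of \<open>g\<^sub>t\<^sub>,\<^sub>i(X\<^sub>t)\<close> up to time \<open>T\<close> is at most \<open>Q\<^sub>i(T+1)\<close> plus
  \<open>G\<close> times the distance travelled by the decisions. Both terms are controlled by a bound on
  \<open>\<parallel>Q\<parallel>\<close>: the step \<open>X\<^sub>t - X\<^sub>t\<^sub>-\<^sub>1\<close> minimises a quadratic of curvature \<open>2\<alpha>\<close> whose slope at the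
  starting point is at most \<open>G(V + \<surd>k \<parallel>Q(t)\<parallel>)\<close>, so it has length at most that slope over \<open>2\<alpha>\<close>
  (\<open>norm_arg_min_step_le\<close>, \<open>step_le\<close>). With \<open>\<alpha> = V\<^sup>2\<close> and \<open>\<parallel>Q\<parallel> \<le> \<theta>V\<close> the step is \<open>O(1/V)\<close>.

  What remains is \<open>\<parallel>Q(t)\<parallel> \<le> \<theta>V\<close>. Strong convexity lets the minimiser be compared with the Slater
  vector \<open>s\<close> with a gain \<open>\<alpha>\<parallel>s - X\<^sub>t\<parallel>\<^sup>2\<close> (\<open>arg_min_pushback\<close>). As every constraint at \<open>s\<close> is at most
  \<open>-\<eta>\<close>, this gives the drift inequality
  \<open>\<parallel>Q(t+1)\<parallel>\<^sup>2/2 - \<parallel>Q(t)\<parallel>\<^sup>2/2 \<le> B + RV - \<eta>\<parallel>Q(t)\<parallel> + \<alpha>\<parallel>s - X\<^sub>t\<^sub>-\<^sub>1\<parallel>\<^sup>2 - \<alpha>\<parallel>s - X\<^sub>t\<parallel>\<^sup>2\<close> (\<open>queue_drift\<close>).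
  A single slot does not give a useful bound, since the proximal terms are of order \<open>\<alpha> = V\<^sup>2\<close>. They
  telescope, however, so over a window of \<open>V + 1\<close> slots they cost only \<open>\<alpha>D\<^sup>2\<close> in total, that is
  \<open>O(V)\<close> per slot. Meanwhile \<open>\<parallel>Q\<parallel>\<close> gains at most \<open>\<delta>\<close> per slot, so if it exceeds \<open>\<theta>V\<close> at the end of
  the window it was nearly that large throughout it, and the negative drift has made it smaller than
  at the start of the window, which is impossible at the first time the bound is exceeded. Within
  the first \<open>V + 1\<close> slots, where no such window fits, \<open>\<parallel>Q\<parallel>\<close> has grown from \<open>0\<close> to at most
  \<open>\<delta>V \<le> \<theta>V\<close> (\<open>window_drift_bound\<close>). The second entry of the maximum \<open>\<theta>\<close> is what the balance over a
  window requires, and for \<open>\<alpha> = V\<^sup>2\<close> it is bounded in \<open>V\<close> (\<open>theta_const_le\<close>).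
\<close>

section \<open>Minimisers of a linear function plus a proximal term\<close>

text \<open>
  The objective along the segment from \<open>x\<close> to \<open>y\<close> is a quadratic in the step size, so minimality of
  \<open>x\<close> makes its slope at \<open>x\<close> nonnegative; the second-order term \<open>\<alpha>\<parallel>y - x\<parallel>\<^sup>2\<close> is then the gain.
\<close>
lemma arg_min_pushback:
  fixes c x y z :: "'a::real_inner"
  assumes min: "is_arg_min (\<lambda>x. c \<bullet> x + \<alpha> * (norm (x - z))\<^sup>2) (\<lambda>x. x \<in> S) x"
    and S: "convex S" "y \<in> S" and \<alpha>: "\<alpha> \<ge> 0"
  shows "c \<bullet> x + \<alpha> * (norm (x - z))\<^sup>2 + \<alpha> * (norm (y - x))\<^sup>2 \<le> c \<bullet> y + \<alpha> * (norm (y - z))\<^sup>2"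
proof -
  let ?J = "\<lambda>x. c \<bullet> x + \<alpha> * (norm (x - z))\<^sup>2"
  define a where "a = c \<bullet> (y - x) + 2 * \<alpha> * ((x - z) \<bullet> (y - x))"
  define b where "b = \<alpha> * (norm (y - x))\<^sup>2"
  have x: "x \<in> S" and le: "\<And>u. u \<in> S \<Longrightarrow> ?J x \<le> ?J u"
    using min by (auto simp: is_arg_min_linorder)
  have expand: "?J (x + l *\<^sub>R (y - x)) = ?J x + l * a + l\<^sup>2 * b" for l
  proof -
    have "(norm (x + l *\<^sub>R (y - x) - z))\<^sup>2 = (norm ((x - z) + l *\<^sub>R (y - x)))\<^sup>2"
      by (simp add: algebra_simps)
    also have "\<dots> = (norm (x - z))\<^sup>2 + 2 * l * ((x - z) \<bullet> (y - x)) + l\<^sup>2 * (norm (y - x))\<^sup>2"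
      unfolding power2_norm_eq_inner
      by (simp only: inner_add_left inner_add_right inner_scaleR_left inner_scaleR_right
            inner_commute[of "y - x" "x - z"])
        (simp add: power2_eq_square algebra_simps)
    finally have sq: "(norm (x + l *\<^sub>R (y - x) - z))\<^sup>2
        = (norm (x - z))\<^sup>2 + 2 * l * ((x - z) \<bullet> (y - x)) + l\<^sup>2 * (norm (y - x))\<^sup>2" .
    have lin: "c \<bullet> (x + l *\<^sub>R (y - x)) = c \<bullet> x + l * (c \<bullet> (y - x))"
      by (simp only: inner_add_right inner_scaleR_right)
    show ?thesis unfolding sq lin a_def b_def by algebra
  qed
  have b: "b \<ge> 0" unfolding b_def using \<alpha> by simp
  have a: "a \<ge> 0"
  proof (rule ccontr)
    assume neg: "\<not> a \<ge> 0"
    \<comment> \<open>any step size with \<open>0 < l\<close>, \<open>l b < - a\<close> and \<open>l \<le> 1\<close> gives a contradiction\<close>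
    define l where "l = - a / (b - a)"
    have ba: "b - a > 0" using neg b by simp
    have l: "0 < l" "l \<le> 1" using neg b ba by (auto simp: l_def field_simps)
    have "(1 - l) *\<^sub>R x + l *\<^sub>R y \<in> S"
      using convexD_alt[OF S(1) x S(2)] l by simp
    hence "x + l *\<^sub>R (y - x) \<in> S" by (simp add: algebra_simps)
    from le[OF this] have "0 \<le> l * (a + l * b)"
      unfolding expand by (simp add: power2_eq_square algebra_simps)
    hence "0 \<le> a + l * b" using l(1) by (simp add: zero_le_mult_iff)
    moreover have "a + l * b = - (a\<^sup>2) / (b - a)"
      using ba by (simp add: l_def field_simps power2_eq_square)
    moreover have "- (a\<^sup>2) / (b - a) < 0" using ba neg by (simp add: divide_neg_pos)
    ultimately show False by simp
  qed
  have "?J y = ?J x + a + b" using expand[of 1] by simp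
  thus ?thesis using a b_def by linarith
qed

text \<open>Staying at the centre \<open>z\<close> is an admissible competitor, which bounds the length of the step.\<close>
lemma norm_arg_min_step_le:
  fixes c x z :: "'a::real_inner"
  assumes min: "is_arg_min (\<lambda>x. c \<bullet> x + \<alpha> * (norm (x - z))\<^sup>2) (\<lambda>x. x \<in> S) x"
    and S: "convex S" "z \<in> S" and \<alpha>: "\<alpha> > 0"
  shows "norm (x - z) \<le> norm c / (2 * \<alpha>)"
proof -
  have "2 * \<alpha> * (norm (x - z))\<^sup>2 \<le> c \<bullet> (z - x)"
    using arg_min_pushback[OF min S] \<alpha> by (simp add: norm_minus_commute inner_diff_right)
  also have "\<dots> \<le> norm c * norm (x - z)"
    using norm_cauchy_schwarz[of c "z - x"] by (simp add: norm_minus_commute)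
  finally have "2 * \<alpha> * norm (x - z) \<le> norm c"
    by (cases "x = z") (simp_all add: power2_eq_square)
  thus ?thesis using \<alpha> by (simp add: field_simps)
qed

section \<open>Drift over a window\<close>

text \<open>
  A negative drift that is disturbed by a telescoping term bounded by \<open>M\<close>. Over \<open>m\<close> slots the
  disturbance adds up to at most \<open>M\<close>, whereas \<open>p\<close> stays above its final value minus \<open>m \<delta>\<close>; the
  term \<open>(m + 1) / 2\<close> is the average of \<open>1, \<dots>, m\<close>. The assumption \<open>start\<close> covers the first \<open>m\<close>
  values, whose indices are at most \<open>m - 1\<close>.
\<close>
lemma window_drift_bound:
  fixes p r :: "nat \<Rightarrow> real"
  assumes p0: "p 0 = 0" and nonneg: "\<And>n. p n \<ge> 0"
    and incr: "\<And>n. p (Suc n) \<le> p n + \<delta>" and \<delta>: "\<delta> \<ge> 0"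
    and drift: "\<And>n. (p (Suc n))\<^sup>2 / 2 - (p n)\<^sup>2 / 2 \<le> C - \<eta> * p n + r n - r (Suc n)"
    and r: "\<And>n. 0 \<le> r n" "\<And>n. r n \<le> M" and \<eta>: "\<eta> > 0"
    and start: "real m * \<delta> \<le> b + \<delta>" and m: "m > 0"
    and balance: "C + M / real m + \<eta> * \<delta> * (real m + 1) / 2 \<le> \<eta> * b"
  shows "p n \<le> b"
proof (induction n rule: less_induct)
  case (less n)
  have incr_many: "p (u + j) \<le> p u + real j * \<delta>" for u j
  proof (induction j)
    case (Suc j)
    thus ?case using incr[of "u + j"] by (simp add: algebra_simps)
  qed simp
  show ?case
  proof (cases "n < m")
    case True
    have "p n \<le> real n * \<delta>" using incr_many[of 0 n] p0 by simp
    also have "\<dots> \<le> (real m - 1) * \<delta>" using True \<delta> by (intro mult_right_mono) auto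
    also have "\<dots> \<le> b" using start by (simp add: algebra_simps)
    finally show ?thesis .
  next
    case False
    define u where "u = n - m"
    have n: "n = u + m" using False by (simp add: u_def)
    show ?thesis
    proof (rule ccontr)
      assume "\<not> p n \<le> b"
      hence big: "p n > b" by simp
      have window: "(p (u + j))\<^sup>2 / 2 \<le> (p u)\<^sup>2 / 2 + real j * C
          - \<eta> * (\<Sum>i<j. p (u + i)) + r u - r (u + j)" for j
      proof (induction j)
        case (Suc j)
        thus ?case using drift[of "u + j"] by (simp add: algebra_simps)
      qed simp
      have arith: "(\<Sum>j<m. real m - real j) = real m * (real m + 1) / 2"
        by (induction m) (simp_all add: sum.distrib sum_subtractf field_simps)
      have "real m * p n - \<delta> * (real m * (real m + 1) / 2)
          = (\<Sum>j<m. p n - (real m - real j) * \<delta>)"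
        unfolding arith[symmetric] sum_distrib_left
        by (subst sum_subtractf) (simp add: mult.commute)
      also have "\<dots> \<le> (\<Sum>j<m. p (u + j))"
      proof (rule sum_mono)
        fix j assume "j \<in> {..<m}"
        hence j: "j < m" by simp
        show "p n - (real m - real j) * \<delta> \<le> p (u + j)"
          using incr_many[of "u + j" "m - j"] j by (simp add: n of_nat_diff)
      qed
      finally have "\<eta> * (real m * p n - \<delta> * (real m * (real m + 1) / 2)) \<le> \<eta> * (\<Sum>j<m. p (u + j))"
        using \<eta> by (intro mult_left_mono) auto
      hence "(p n)\<^sup>2 / 2 \<le> (p u)\<^sup>2 / 2 + real m * C
          - \<eta> * (real m * p n - \<delta> * (real m * (real m + 1) / 2)) + M"
        using window[of m] r(1)[of n] r(2)[of u] unfolding n by linarith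
      also have "\<dots> = (p u)\<^sup>2 / 2
          + real m * (C + M / real m + \<eta> * \<delta> * (real m + 1) / 2 - \<eta> * p n)"
        using m by (simp add: field_simps)
      also have "\<dots> < (p u)\<^sup>2 / 2"
      proof -
        have "\<eta> * b < \<eta> * p n" using big \<eta> by simp
        hence "C + M / real m + \<eta> * \<delta> * (real m + 1) / 2 - \<eta> * p n < 0"
          using balance by linarith
        thus ?thesis using m by (simp add: mult_pos_neg)
      qed
      finally have "p n < p u"
        using nonneg[of u] by (simp add: power2_less_imp_less)
      moreover have "p u \<le> b" using less.IH[of u] m n by simp
      ultimately show False using big by simp
    qed
  qed
qed

section \<open>A run of the algorithm under the Slater condition\<close>

text \<open>
  The step parameter \<open>\<alpha>\<close> is kept independent of \<open>V\<close> as long as possible. Slots are counted from \<open>0\<close>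
  by \<open>n\<close>, so that \<open>Q i (Suc n)\<close> is the queue that is used to pass from \<open>X n\<close> to \<open>X (Suc n)\<close>.
\<close>
locale slater_run =
  fixes S :: "'a::real_inner set" and k :: nat
    and f :: "nat \<Rightarrow> 'a \<Rightarrow> real" and g :: "nat \<Rightarrow> nat \<Rightarrow> 'a \<Rightarrow> real"
    and f' :: "nat \<Rightarrow> 'a \<Rightarrow> 'a" and g' :: "nat \<Rightarrow> nat \<Rightarrow> 'a \<Rightarrow> 'a"
    and D F G \<eta> V \<alpha> :: real and s x0 :: 'a
    and X :: "nat \<Rightarrow> 'a" and Q :: "nat \<Rightarrow> nat \<Rightarrow> real"
  assumes convex: "convex S"
    and diameter: "\<And>x y. x \<in> S \<Longrightarrow> y \<in> S \<Longrightarrow> norm (x - y) \<le> D"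
    and f_bound: "\<And>t x. x \<in> S \<Longrightarrow> \<bar>f t x\<bar> \<le> F"
    and g_bound: "\<And>t i x. i \<in> {1..k} \<Longrightarrow> x \<in> S \<Longrightarrow> \<bar>g t i x\<bar> \<le> F"
    and f_subgradient: "\<And>t x. x \<in> S \<Longrightarrow> is_subgradient_on S (f t) x (f' t x)"
    and g_subgradient:
      "\<And>t i x. i \<in> {1..k} \<Longrightarrow> x \<in> S \<Longrightarrow> is_subgradient_on S (g t i) x (g' t i x)"
    and f'_bound: "\<And>t x. x \<in> S \<Longrightarrow> norm (f' t x) \<le> G"
    and g'_bound: "\<And>t i x. i \<in> {1..k} \<Longrightarrow> x \<in> S \<Longrightarrow> norm (g' t i x) \<le> G"
    and slater: "slater_vector S k g \<eta> s"
    and start: "x0 \<in> S"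
    and run: "online_run S k f' g g' V \<alpha> x0 X Q"
    and V_pos: "V > 0" and \<alpha>_pos: "\<alpha> > 0"
begin

definition linearized :: "nat \<Rightarrow> nat \<Rightarrow> real" where
  "linearized i n = g n i (X n) + g' n i (X n) \<bullet> (X (Suc n) - X n)"

definition queue_norm :: "nat \<Rightarrow> real" where
  "queue_norm n = L2_set (\<lambda>i. Q i (Suc n)) {1..k}"

definition descent_direction :: "nat \<Rightarrow> 'a" where
  "descent_direction n = V *\<^sub>R f' n (X n) + (\<Sum>i=1..k. Q i (Suc n) *\<^sub>R g' n i (X n))"

lemma \<eta>_pos: "\<eta> > 0" and s_mem: "s \<in> S" and slater_le: "i \<in> {1..k} \<Longrightarrow> g t i s \<le> - \<eta>"
  using slater by (auto simp: slater_vector_def)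

lemma G_nonneg: "G \<ge> 0"
  using f'_bound[OF s_mem, of 0] norm_ge_zero order_trans by blast

lemma queue_init: "i \<in> {1..k} \<Longrightarrow> Q i (Suc 0) = 0"
  using run by (simp add: online_run_def)

lemma queue_Suc:
  assumes "i \<in> {1..k}"
  shows "Q i (Suc (Suc n)) = max (Q i (Suc n) + linearized i n) 0"
proof -
  have "\<forall>t\<ge>1. Q i (t + 1) =
      max (Q i t + g (t - 1) i (X (t - 1)) + g' (t - 1) i (X (t - 1)) \<bullet> (X t - X (t - 1))) 0"
    using run assms by (simp add: online_run_def)
  from this[rule_format, of "Suc n"] show ?thesis by (simp add: linearized_def add.assoc)
qed

lemma queue_nonneg: "i \<in> {1..k} \<Longrightarrow> Q i (Suc n) \<ge> 0"
  by (cases n) (simp_all add: queue_init queue_Suc del: atLeastAtMost_iff)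

lemma X_Suc:
  "is_arg_min (\<lambda>x. descent_direction n \<bullet> x + \<alpha> * (norm (x - X n))\<^sup>2) (\<lambda>x. x \<in> S) (X (Suc n))"
proof -
  have "\<forall>t\<ge>1. is_arg_min
        (\<lambda>x. (V *\<^sub>R f' (t - 1) (X (t - 1)) + (\<Sum>i=1..k. Q i t *\<^sub>R g' (t - 1) i (X (t - 1)))) \<bullet> x
              + \<alpha> * (norm (x - X (t - 1)))\<^sup>2)
        (\<lambda>x. x \<in> S) (X t)"
    using run by (simp add: online_run_def)
  from this[rule_format, of "Suc n"] show ?thesis by (simp add: descent_direction_def)
qed

lemma X_mem: "X n \<in> S"
proof (cases n)
  case 0
  thus ?thesis using run start by (simp add: online_run_def)
next
  case (Suc m)
  thus ?thesis using X_Suc[of m] by (simp add: is_arg_min_def)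
qed

lemma abs_linearized_le:
  assumes "i \<in> {1..k}"
  shows "\<bar>linearized i n\<bar> \<le> F + G * D"
proof -
  have "\<bar>g' n i (X n) \<bullet> (X (Suc n) - X n)\<bar> \<le> norm (g' n i (X n)) * norm (X (Suc n) - X n)"
    by (rule Cauchy_Schwarz_ineq2)
  also have "\<dots> \<le> G * D"
    using g'_bound[OF assms X_mem] diameter[OF X_mem X_mem] G_nonneg by (intro mult_mono) auto
  finally show ?thesis
    using g_bound[OF assms X_mem, of n n] unfolding linearized_def by linarith
qed

lemma queue_norm_nonneg: "queue_norm n \<ge> 0"
  by (simp add: queue_norm_def L2_set_nonneg)

lemma queue_norm_0: "queue_norm 0 = 0"
  by (simp add: queue_norm_def L2_set_def queue_init del: atLeastAtMost_iff)

lemma queue_le_queue_norm: "i \<in> {1..k} \<Longrightarrow> Q i (Suc n) \<le> queue_norm n"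
  unfolding queue_norm_def by (rule member_le_L2_set) auto

lemma queue_norm_le_sum: "queue_norm n \<le> (\<Sum>i=1..k. Q i (Suc n))"
  unfolding queue_norm_def by (rule L2_set_le_sum) (rule queue_nonneg)

lemma sum_queue_le: "(\<Sum>i=1..k. Q i (Suc n)) \<le> sqrt (real k) * queue_norm n"
proof -
  have "(\<Sum>i=1..k. Q i (Suc n)) = (\<Sum>i=1..k. \<bar>1\<bar> * \<bar>Q i (Suc n)\<bar>)"
    by (intro sum.cong) (simp_all add: queue_nonneg)
  also have "\<dots> \<le> L2_set (\<lambda>i. 1) {1..k} * queue_norm n"
    unfolding queue_norm_def by (rule L2_set_mult_ineq)
  finally show ?thesis by (simp add: L2_set_def)
qed

lemma queue_norm_Suc_le: "queue_norm (Suc n) \<le> queue_norm n + delta_const k F G D"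
proof -
  have "F \<ge> 0" using f_bound[OF s_mem, of 0] by linarith
  moreover have "D \<ge> 0" using diameter[OF s_mem s_mem] by simp
  ultimately have c: "F + G * D \<ge> 0" using G_nonneg by simp
  have "queue_norm (Suc n) \<le> L2_set (\<lambda>i. Q i (Suc n) + (F + G * D)) {1..k}"
    unfolding queue_norm_def
  proof (rule L2_set_mono)
    fix i assume i: "i \<in> {1..k}"
    show "Q i (Suc (Suc n)) \<le> Q i (Suc n) + (F + G * D)"
      using abs_linearized_le[OF i, of n] queue_nonneg[OF i, of n] c by (simp add: queue_Suc[OF i])
    show "0 \<le> Q i (Suc (Suc n))" by (rule queue_nonneg[OF i])
  qed
  also have "\<dots> \<le> queue_norm n + L2_set (\<lambda>i. F + G * D) {1..k}"
    unfolding queue_norm_def by (rule L2_set_triangle_ineq)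
  also have "L2_set (\<lambda>i. F + G * D) {1..k} = delta_const k F G D"
    using c by (simp add: L2_set_def delta_const_def real_sqrt_mult mult.commute)
  finally show ?thesis by simp
qed

text \<open>Squaring \<open>max a 0 \<le> \<bar>a\<bar>\<close> for each queue leaves the second-order terms, which make up \<open>B\<close>.\<close>
lemma queue_norm_square_drift:
  "(queue_norm (Suc n))\<^sup>2 / 2 - (queue_norm n)\<^sup>2 / 2
     \<le> B_const k F G D + (\<Sum>i=1..k. Q i (Suc n) * linearized i n)"
proof -
  have sq: "(queue_norm m)\<^sup>2 = (\<Sum>i=1..k. (Q i (Suc m))\<^sup>2)" for m
    unfolding queue_norm_def L2_set_def by (intro real_sqrt_pow2 sum_nonneg) simp
  have "(\<Sum>i=1..k. (Q i (Suc (Suc n)))\<^sup>2)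
      \<le> (\<Sum>i=1..k. (Q i (Suc n))\<^sup>2 + 2 * (Q i (Suc n) * linearized i n) + (F + G * D)\<^sup>2)"
  proof (rule sum_mono)
    fix i assume i: "i \<in> {1..k}"
    have "(Q i (Suc (Suc n)))\<^sup>2 \<le> (Q i (Suc n) + linearized i n)\<^sup>2"
      by (simp add: queue_Suc[OF i] max_def)
    also have "\<dots> = (Q i (Suc n))\<^sup>2 + 2 * (Q i (Suc n) * linearized i n) + (linearized i n)\<^sup>2"
      by (simp add: power2_sum)
    also have "(linearized i n)\<^sup>2 \<le> (F + G * D)\<^sup>2"
      using power_mono[OF abs_linearized_le[OF i] abs_ge_zero, of n 2] by simp
    finally show "(Q i (Suc (Suc n)))\<^sup>2
        \<le> (Q i (Suc n))\<^sup>2 + 2 * (Q i (Suc n) * linearized i n) + (F + G * D)\<^sup>2"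
      by simp
  qed
  also have "\<dots> = (\<Sum>i=1..k. (Q i (Suc n))\<^sup>2) + 2 * (\<Sum>i=1..k. Q i (Suc n) * linearized i n)
      + 2 * B_const k F G D"
    by (simp add: sum.distrib sum_distrib_left B_const_def)
  finally show ?thesis unfolding sq by simp
qed

lemma inner_descent_direction:
  "descent_direction n \<bullet> v = V * (f' n (X n) \<bullet> v) + (\<Sum>i=1..k. Q i (Suc n) * (g' n i (X n) \<bullet> v))"
  by (simp add: descent_direction_def inner_add_left inner_sum_left)

text \<open>
  The minimiser \<open>X (Suc n)\<close> is compared with \<open>s\<close>: the linear terms at \<open>s\<close> are replaced by function
  values through the subgradient inequalities, and the loss term \<open>V f' \<bullet> d\<close> of the step \<open>d\<close> is
  absorbed by \<open>\<alpha>\<parallel>d\<parallel>\<^sup>2\<close> through completion of the square.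
\<close>
lemma queue_drift:
  "(queue_norm (Suc n))\<^sup>2 / 2 - (queue_norm n)\<^sup>2 / 2
     \<le> B_const k F G D + R_const F G V \<alpha> * V - \<eta> * queue_norm n
       + \<alpha> * (norm (s - X n))\<^sup>2 - \<alpha> * (norm (s - X (Suc n)))\<^sup>2"
proof -
  define d where "d = X (Suc n) - X n"
  define w where "w = s - X n"
  have push: "descent_direction n \<bullet> d + \<alpha> * (norm d)\<^sup>2 + \<alpha> * (norm (s - X (Suc n)))\<^sup>2
      \<le> descent_direction n \<bullet> w + \<alpha> * (norm w)\<^sup>2"
    using arg_min_pushback[OF X_Suc convex s_mem less_imp_le[OF \<alpha>_pos], of n]
    by (simp add: d_def w_def inner_diff_right)
  have at_s: "descent_direction n \<bullet> w
      \<le> V * (2 * F) + (\<Sum>i=1..k. - \<eta> * Q i (Suc n) - Q i (Suc n) * g n i (X n))"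
  proof -
    have "f n (X n) + f' n (X n) \<bullet> w \<le> f n s"
      using f_subgradient[OF X_mem, of n n] s_mem by (simp add: is_subgradient_on_def w_def)
    hence "f' n (X n) \<bullet> w \<le> 2 * F"
      using f_bound[OF s_mem, of n] f_bound[OF X_mem, of n n] by linarith
    hence "V * (f' n (X n) \<bullet> w) \<le> V * (2 * F)" using V_pos by simp
    moreover have "(\<Sum>i=1..k. Q i (Suc n) * (g' n i (X n) \<bullet> w))
        \<le> (\<Sum>i=1..k. - \<eta> * Q i (Suc n) - Q i (Suc n) * g n i (X n))"
    proof (rule sum_mono)
      fix i assume i: "i \<in> {1..k}"
      have "g n i (X n) + g' n i (X n) \<bullet> w \<le> g n i s"
        using g_subgradient[OF i X_mem, of n n] s_mem by (simp add: is_subgradient_on_def w_def)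
      hence "g' n i (X n) \<bullet> w \<le> - \<eta> - g n i (X n)" using slater_le[OF i, of n] by linarith
      from mult_left_mono[OF this queue_nonneg[OF i, of n]]
      show "Q i (Suc n) * (g' n i (X n) \<bullet> w) \<le> - \<eta> * Q i (Suc n) - Q i (Suc n) * g n i (X n)"
        by (simp add: algebra_simps)
    qed
    ultimately show ?thesis unfolding inner_descent_direction by linarith
  qed
  have lin: "(\<Sum>i=1..k. Q i (Suc n) * linearized i n)
      = (\<Sum>i=1..k. Q i (Suc n) * g n i (X n)) + descent_direction n \<bullet> d - V * (f' n (X n) \<bullet> d)"
    unfolding inner_descent_direction linearized_def d_def
    by (simp add: distrib_left sum.distrib)
  have square: "- V * (f' n (X n) \<bullet> d) \<le> V\<^sup>2 * G\<^sup>2 / (4 * \<alpha>) + \<alpha> * (norm d)\<^sup>2"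
  proof -
    have "- (f' n (X n) \<bullet> d) \<le> norm (f' n (X n)) * norm d"
      using Cauchy_Schwarz_ineq2[of "f' n (X n)" d] by linarith
    also have "\<dots> \<le> G * norm d" using f'_bound[OF X_mem] by (intro mult_right_mono) auto
    finally have "V * (- (f' n (X n) \<bullet> d)) \<le> V * (G * norm d)"
      using V_pos by (intro mult_left_mono) auto
    moreover have "0 \<le> (V * G - 2 * \<alpha> * norm d)\<^sup>2 / (4 * \<alpha>)" using \<alpha>_pos by simp
    moreover have "(V * G - 2 * \<alpha> * norm d)\<^sup>2 / (4 * \<alpha>)
        = V\<^sup>2 * G\<^sup>2 / (4 * \<alpha>) + \<alpha> * (norm d)\<^sup>2 - V * (G * norm d)"
      using \<alpha>_pos by (simp add: power2_eq_square field_simps)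
    ultimately show ?thesis by linarith
  qed
  have R: "V\<^sup>2 * G\<^sup>2 / (4 * \<alpha>) + V * (2 * F) \<le> R_const F G V \<alpha> * V"
  proof -
    have "V\<^sup>2 * G\<^sup>2 / (4 * \<alpha>) \<le> V\<^sup>2 * G\<^sup>2 / (2 * \<alpha>)"
      using \<alpha>_pos by (intro divide_left_mono) auto
    thus ?thesis by (simp add: R_const_def power2_eq_square algebra_simps)
  qed
  have norm_sum: "\<eta> * queue_norm n \<le> \<eta> * (\<Sum>i=1..k. Q i (Suc n))"
    using queue_norm_le_sum \<eta>_pos by (intro mult_left_mono) auto
  have "(\<Sum>i=1..k. - \<eta> * Q i (Suc n) - Q i (Suc n) * g n i (X n))
      = - (\<eta> * (\<Sum>i=1..k. Q i (Suc n))) - (\<Sum>i=1..k. Q i (Suc n) * g n i (X n))"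
    by (simp add: sum_subtractf sum_distrib_left sum_negf)
  thus ?thesis
    using queue_norm_square_drift[of n] push at_s lin square R norm_sum unfolding w_def by linarith
qed

lemma delta_const_nonneg: "delta_const k F G D \<ge> 0"
  using queue_norm_Suc_le[of 0] queue_norm_nonneg[of 1] by (simp add: queue_norm_0)

text \<open>
  The window has \<open>V + 1\<close> slots, for which \<open>\<eta> V\<close> times the second entry of the maximum \<open>\<theta>\<close> is
  the left-hand side of the balance condition.
\<close>
lemma queue_norm_le:
  assumes V: "V = real N"
  shows "queue_norm n \<le> theta_const k F G D \<eta> V \<alpha> * V"
proof (rule window_drift_bound[where p = queue_norm and \<delta> = "delta_const k F G D"
      and r = "\<lambda>n. \<alpha> * (norm (s - X n))\<^sup>2" and M = "\<alpha> * D\<^sup>2" and \<eta> = \<eta> and m = "Suc N"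
      and C = "B_const k F G D + R_const F G V \<alpha> * V"])
  let ?\<theta> = "theta_const k F G D \<eta> V \<alpha>"
  let ?\<delta> = "delta_const k F G D"
  let ?C = "B_const k F G D + R_const F G V \<alpha> * V"
  show "(queue_norm (Suc n))\<^sup>2 / 2 - (queue_norm n)\<^sup>2 / 2
      \<le> ?C - \<eta> * queue_norm n + \<alpha> * (norm (s - X n))\<^sup>2 - \<alpha> * (norm (s - X (Suc n)))\<^sup>2" for n
    by (rule queue_drift)
  show "\<alpha> * (norm (s - X n))\<^sup>2 \<le> \<alpha> * D\<^sup>2" for n
    using \<alpha>_pos diameter[OF s_mem X_mem] by (intro mult_left_mono power_mono) auto
  show "real (Suc N) * ?\<delta> \<le> ?\<theta> * V + ?\<delta>"
  proof -
    have "?\<delta> * V \<le> ?\<theta> * V"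
      using V_pos by (intro mult_right_mono) (auto simp: theta_const_def)
    thus ?thesis using V by (simp add: algebra_simps)
  qed
  show "?C + \<alpha> * D\<^sup>2 / real (Suc N) + \<eta> * ?\<delta> * (real (Suc N) + 1) / 2 \<le> \<eta> * (?\<theta> * V)"
  proof -
    have "?C / (\<eta> * V) + \<alpha> * D\<^sup>2 / (\<eta> * V * (V + 1)) + ?\<delta> * (V + 2) / (2 * V) \<le> ?\<theta>"
      by (simp add: theta_const_def)
    hence "(\<eta> * V) * (?C / (\<eta> * V) + \<alpha> * D\<^sup>2 / (\<eta> * V * (V + 1)) + ?\<delta> * (V + 2) / (2 * V))
        \<le> (\<eta> * V) * ?\<theta>"
      using \<eta>_pos V_pos by (intro mult_left_mono) auto
    moreover have "(\<eta> * V) * (?C / (\<eta> * V) + \<alpha> * D\<^sup>2 / (\<eta> * V * (V + 1)) + ?\<delta> * (V + 2) / (2 * V))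
        = ?C + \<alpha> * D\<^sup>2 / (V + 1) + \<eta> * ?\<delta> * (V + 2) / 2"
    proof -
      have cancel: "W * (x / (W * y)) = x / y" if "W > 0" for W x y :: real
        using that by simp
      have "(\<eta> * V) * (\<alpha> * D\<^sup>2 / (\<eta> * V * (V + 1))) = \<alpha> * D\<^sup>2 / (V + 1)"
        using \<eta>_pos V_pos by (intro cancel) simp
      moreover have "(\<eta> * V) * (?C / (\<eta> * V)) = ?C" using \<eta>_pos V_pos by simp
      moreover have "(\<eta> * V) * (?\<delta> * (V + 2) / (2 * V)) = \<eta> * ?\<delta> * (V + 2) / 2"
        using V_pos by (simp add: field_simps)
      ultimately show ?thesis by (simp only: distrib_left[of "\<eta> * V"])
    qed
    ultimately show ?thesis using V by (simp add: algebra_simps)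
  qed
qed (use \<alpha>_pos \<eta>_pos in \<open>auto simp: queue_norm_0 queue_norm_nonneg queue_norm_Suc_le
       delta_const_nonneg\<close>)

lemma step_le: "norm (X (Suc n) - X n) \<le> G * (V + sqrt (real k) * queue_norm n) / (2 * \<alpha>)"
proof -
  have "norm (descent_direction n)
      \<le> norm (V *\<^sub>R f' n (X n)) + (\<Sum>i=1..k. norm (Q i (Suc n) *\<^sub>R g' n i (X n)))"
    unfolding descent_direction_def by (intro norm_triangle_le add_left_mono norm_sum)
  also have "\<dots> \<le> V * G + (\<Sum>i=1..k. Q i (Suc n) * G)"
    using V_pos f'_bound[OF X_mem] g'_bound[OF _ X_mem]
    by (intro add_mono sum_mono) (auto simp: queue_nonneg intro!: mult_left_mono)
  also have "\<dots> = G * (V + (\<Sum>i=1..k. Q i (Suc n)))"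
    by (simp add: sum_distrib_left sum_distrib_right algebra_simps)
  also have "\<dots> \<le> G * (V + sqrt (real k) * queue_norm n)"
    using sum_queue_le G_nonneg by (intro mult_left_mono add_left_mono) auto
  finally have "norm (descent_direction n) / (2 * \<alpha>)
      \<le> G * (V + sqrt (real k) * queue_norm n) / (2 * \<alpha>)"
    using \<alpha>_pos by (intro divide_right_mono) auto
  with norm_arg_min_step_le[OF X_Suc convex X_mem \<alpha>_pos, of n] show ?thesis by linarith
qed

lemma sum_constraint_le:
  assumes "i \<in> {1..k}"
  shows "(\<Sum>t<T. g t i (X t)) \<le> Q i (Suc T) + G * (\<Sum>t<T. norm (X (Suc t) - X t))"
proof (induction T)
  case 0
  show ?case by (simp add: queue_nonneg[OF assms])
next
  case (Suc T)
  have "- (g' T i (X T) \<bullet> (X (Suc T) - X T)) \<le> norm (g' T i (X T)) * norm (X (Suc T) - X T)"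
    using Cauchy_Schwarz_ineq2[of "g' T i (X T)" "X (Suc T) - X T"] by linarith
  also have "\<dots> \<le> G * norm (X (Suc T) - X T)"
    using g'_bound[OF assms X_mem] by (intro mult_right_mono) auto
  finally have "g T i (X T) \<le> linearized i T + G * norm (X (Suc T) - X T)"
    unfolding linearized_def by linarith
  moreover have "Q i (Suc T) + linearized i T \<le> Q i (Suc (Suc T))"
    by (simp add: queue_Suc[OF assms])
  ultimately show ?case using Suc.IH by (simp add: distrib_left)
qed

text \<open>
  The direct estimate has the error \<open>G\<^sup>2 a / (2V)\<close> with \<open>a = 1 + \<theta> \<surd>k\<close>; \<open>2 a \<le> 1 + a\<^sup>2\<close> turns it into
  the two quadratic terms.
\<close>
lemma average_constraint_le:
  assumes V: "V = real N" and \<alpha>: "\<alpha> = V\<^sup>2" and i: "i \<in> {1..k}" and T: "T > 0"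
    and \<theta>: "\<theta> = theta_const k F G D \<eta> V \<alpha>"
  shows "1 / real T * (\<Sum>t=0..T-1. g t i (X t))
    \<le> \<theta> * V / real T + G\<^sup>2 / (4 * V) + G\<^sup>2 * (1 + \<theta> * sqrt (real k))\<^sup>2 / (4 * V)"
proof -
  let ?a = "1 + \<theta> * sqrt (real k)"
  have q: "queue_norm n \<le> \<theta> * V" for n using queue_norm_le[OF V] \<theta> by simp
  have step: "norm (X (Suc t) - X t) \<le> G * ?a / (2 * V)" for t
  proof -
    have "G * (V + sqrt (real k) * queue_norm t) / (2 * \<alpha>)
        \<le> G * (V + sqrt (real k) * (\<theta> * V)) / (2 * \<alpha>)"
      using q G_nonneg \<alpha>_pos
      by (intro divide_right_mono mult_left_mono add_left_mono) auto
    also have "\<dots> = G * ?a / (2 * V)"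
      using V_pos by (simp add: \<alpha> power2_eq_square field_simps)
    finally show ?thesis using step_le[of t] by linarith
  qed
  have "(\<Sum>t<T. norm (X (Suc t) - X t)) \<le> real T * (G * ?a / (2 * V))"
    using sum_mono[of "{..<T}", OF step] by simp
  hence "G * (\<Sum>t<T. norm (X (Suc t) - X t)) \<le> G * (real T * (G * ?a / (2 * V)))"
    using G_nonneg by (rule mult_left_mono)
  moreover have "Q i (Suc T) \<le> \<theta> * V"
    using queue_le_queue_norm[OF i, of T] q[of T] by linarith
  ultimately have "(\<Sum>t<T. g t i (X t)) \<le> \<theta> * V + G * (real T * (G * ?a / (2 * V)))"
    using sum_constraint_le[OF i, of T] by linarith
  hence "1 / real T * (\<Sum>t<T. g t i (X t))
      \<le> 1 / real T * (\<theta> * V + G * (real T * (G * ?a / (2 * V))))"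
    by (intro mult_left_mono) auto
  also have "\<dots> = \<theta> * V / real T + G\<^sup>2 / (4 * V) * (2 * ?a)"
    using T V_pos by (simp add: field_simps power2_eq_square)
  also have "\<dots> \<le> \<theta> * V / real T + G\<^sup>2 / (4 * V) * (1 + ?a\<^sup>2)"
  proof -
    have "2 * ?a \<le> 1 + ?a\<^sup>2" using sum_squares_bound[of 1 ?a] by simp
    thus ?thesis using V_pos by (intro add_left_mono mult_left_mono) auto
  qed
  also have "\<dots> = \<theta> * V / real T + G\<^sup>2 / (4 * V) + G\<^sup>2 * ?a\<^sup>2 / (4 * V)"
    by (simp add: distrib_left)
  also have "{..<T} = {0..T-1}" using T by auto
  finally show ?thesis .
qed

end

section \<open>Uniformity in the parameter\<close>

text \<open>The choice \<open>\<alpha> = V\<^sup>2\<close> is the largest order for which the term \<open>\<alpha> / (V (V + 1))\<close> stays bounded.\<close>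
lemma theta_const_le:
  assumes V: "V \<ge> 1" and \<eta>: "\<eta> > 0" and nonneg: "F \<ge> 0" "G \<ge> 0" "D \<ge> 0"
  shows "theta_const k F G D \<eta> V (V\<^sup>2)
    \<le> (B_const k F G D + G\<^sup>2 / 2 + 2 * F) / \<eta> + D\<^sup>2 / \<eta> + 2 * delta_const k F G D"
proof -
  let ?B = "B_const k F G D"
  let ?\<delta> = "delta_const k F G D"
  have B: "?B \<ge> 0" by (simp add: B_const_def)
  have \<delta>: "?\<delta> \<ge> 0" using nonneg by (simp add: delta_const_def)
  have "(?B + R_const F G V (V\<^sup>2) * V) / (\<eta> * V) = (?B / V + G\<^sup>2 / 2 / V + 2 * F) / \<eta>"
    using V \<eta> by (simp add: R_const_def field_simps power2_eq_square)
  also have "\<dots> \<le> (?B + G\<^sup>2 / 2 + 2 * F) / \<eta>"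
  proof -
    have "x / V \<le> x" if "x \<ge> 0" for x :: real
      using divide_left_mono[of 1 V x] that V by simp
    thus ?thesis using B \<eta> by (intro divide_right_mono add_mono) auto
  qed
  finally have 1: "(?B + R_const F G V (V\<^sup>2) * V) / (\<eta> * V) \<le> (?B + G\<^sup>2 / 2 + 2 * F) / \<eta>" .
  have "V\<^sup>2 * D\<^sup>2 / (\<eta> * V * (V + 1)) = (V * (D\<^sup>2 * V)) / (V * (\<eta> * (V + 1)))"
    by (simp only: power2_eq_square mult_ac)
  also have "\<dots> = (D\<^sup>2 / \<eta>) * (V / (V + 1))"
    using V by simp
  also have "\<dots> \<le> (D\<^sup>2 / \<eta>) * 1"
    using V \<eta> by (intro mult_left_mono) auto
  finally have 2: "V\<^sup>2 * D\<^sup>2 / (\<eta> * V * (V + 1)) \<le> D\<^sup>2 / \<eta>" by simp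
  have "?\<delta> * (V + 2) / (2 * V) = ?\<delta> * ((V + 2) / (2 * V))" by simp
  also have "\<dots> \<le> ?\<delta> * 2" using V \<delta> by (intro mult_left_mono) (auto simp: field_simps)
  finally have 3: "?\<delta> * (V + 2) / (2 * V) \<le> 2 * ?\<delta>" by simp
  have "(?B + G\<^sup>2 / 2 + 2 * F) / \<eta> + D\<^sup>2 / \<eta> \<ge> 0" using B \<eta> nonneg by simp
  hence "?\<delta> \<le> (?B + G\<^sup>2 / 2 + 2 * F) / \<eta> + D\<^sup>2 / \<eta> + 2 * ?\<delta>" using \<delta> by linarith
  thus ?thesis unfolding theta_const_def using 1 2 3 by simp
qed

theorem theorem3:
  fixes \<X> :: "(real ^ 'n) set"
    and k :: nat
    and f :: "nat \<Rightarrow> real ^ 'n \<Rightarrow> real"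
    and g :: "nat \<Rightarrow> nat \<Rightarrow> real ^ 'n \<Rightarrow> real"
    and f' :: "nat \<Rightarrow> real ^ 'n \<Rightarrow> real ^ 'n"
    and g' :: "nat \<Rightarrow> nat \<Rightarrow> real ^ 'n \<Rightarrow> real ^ 'n"
    and D F G \<eta> :: real
    and s x0 :: "real ^ 'n"
  assumes "k \<ge> 1"
    and "convex \<X>" and "compact \<X>"
    and "D \<ge> 0" and "\<And>x y. x \<in> \<X> \<Longrightarrow> y \<in> \<X> \<Longrightarrow> norm (x - y) \<le> D"
    and "\<And>t. continuous_on \<X> (f t)" and "\<And>t. convex_on \<X> (f t)"
    and "\<And>t i. i \<in> {1..k} \<Longrightarrow> continuous_on \<X> (g t i)"
    and "\<And>t i. i \<in> {1..k} \<Longrightarrow> convex_on \<X> (g t i)"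
    and "F \<ge> 0"
    and "\<And>t x. x \<in> \<X> \<Longrightarrow> \<bar>f t x\<bar> \<le> F"
    and "\<And>t i x. i \<in> {1..k} \<Longrightarrow> x \<in> \<X> \<Longrightarrow> \<bar>g t i x\<bar> \<le> F"
    and "\<And>t x. x \<in> \<X> \<Longrightarrow> is_subgradient_on \<X> (f t) x (f' t x)"
    and "\<And>t i x. i \<in> {1..k} \<Longrightarrow> x \<in> \<X> \<Longrightarrow> is_subgradient_on \<X> (g t i) x (g' t i x)"
    and "G > 0"
    and "\<And>t x. x \<in> \<X> \<Longrightarrow> norm (f' t x) \<le> G"
    and "\<And>t i x. i \<in> {1..k} \<Longrightarrow> x \<in> \<X> \<Longrightarrow> norm (g' t i x) \<le> G"
    and "slater_vector \<X> k g \<eta> s"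
    and "x0 \<in> \<X>"
  shows "(\<forall>V::nat. V > 0 \<longrightarrow>
            (\<forall>X Q. online_run \<X> k f' g g' (real V) ((real V)\<^sup>2) x0 X Q \<longrightarrow>
              (let \<theta> = theta_const k F G D \<eta> (real V) ((real V)\<^sup>2) in
               \<forall>i\<in>{1..k}. \<forall>T::nat. T > 0 \<longrightarrow>
                 1 / real T * (\<Sum>t=0..T-1. g t i (X t))
                   \<le> \<theta> * real V / real T + G\<^sup>2 / (4 * real V)
                     + G\<^sup>2 * (1 + \<theta> * sqrt (real k))\<^sup>2 / (4 * real V)))) \<and>
         (\<exists>c::real. \<forall>V::nat. V > 0 \<longrightarrow>
            (\<forall>X Q. online_run \<X> k f' g g' (real V) ((real V)\<^sup>2) x0 X Q \<longrightarrow>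
              (\<forall>i\<in>{1..k}. \<forall>T::nat. T \<ge> V\<^sup>2 \<longrightarrow>
                 1 / real T * (\<Sum>t=0..T-1. g t i (X t)) \<le> c / real V)))"
proof (rule conjI)
  have run: "slater_run \<X> k f g f' g' D F G \<eta> (real V) ((real V)\<^sup>2) s x0 X Q"
    if "V > 0" "online_run \<X> k f' g g' (real V) ((real V)\<^sup>2) x0 X Q" for V X Q
    using that assms by unfold_locales auto
  have bound: "1 / real T * (\<Sum>t=0..T-1. g t i (X t))
      \<le> \<theta> * real V / real T + G\<^sup>2 / (4 * real V) + G\<^sup>2 * (1 + \<theta> * sqrt (real k))\<^sup>2 / (4 * real V)"
    if "V > 0" "online_run \<X> k f' g g' (real V) ((real V)\<^sup>2) x0 X Q" "i \<in> {1..k}" "T > 0"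
      "\<theta> = theta_const k F G D \<eta> (real V) ((real V)\<^sup>2)" for V X Q i T \<theta>
    using slater_run.average_constraint_le[OF run[OF that(1,2)] refl refl that(3-5)] .
  show "\<forall>V::nat. V > 0 \<longrightarrow>
            (\<forall>X Q. online_run \<X> k f' g g' (real V) ((real V)\<^sup>2) x0 X Q \<longrightarrow>
              (let \<theta> = theta_const k F G D \<eta> (real V) ((real V)\<^sup>2) in
               \<forall>i\<in>{1..k}. \<forall>T::nat. T > 0 \<longrightarrow>
                 1 / real T * (\<Sum>t=0..T-1. g t i (X t))
                   \<le> \<theta> * real V / real T + G\<^sup>2 / (4 * real V)
                     + G\<^sup>2 * (1 + \<theta> * sqrt (real k))\<^sup>2 / (4 * real V)))"
    unfolding Let_def by (intro allI impI ballI bound) auto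
  define \<Theta> where "\<Theta> = (B_const k F G D + G\<^sup>2 / 2 + 2 * F) / \<eta> + D\<^sup>2 / \<eta> + 2 * delta_const k F G D"
  define c where "c = \<Theta> + G\<^sup>2 / 4 + G\<^sup>2 * (1 + \<Theta> * sqrt (real k))\<^sup>2 / 4"
  have \<eta>: "\<eta> > 0" using \<open>slater_vector \<X> k g \<eta> s\<close> by (simp add: slater_vector_def)
  have "1 / real T * (\<Sum>t=0..T-1. g t i (X t)) \<le> c / real V"
    if V: "V > 0" and r: "online_run \<X> k f' g g' (real V) ((real V)\<^sup>2) x0 X Q"
      and i: "i \<in> {1..k}" and T: "T \<ge> V\<^sup>2" for V X Q i T
  proof -
    define \<theta> where "\<theta> = theta_const k F G D \<eta> (real V) ((real V)\<^sup>2)"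
    have T_pos: "T > 0" using V T by (cases T) auto
    have \<theta>_le: "\<theta> \<le> \<Theta>"
      unfolding \<theta>_def \<Theta>_def using V \<eta> \<open>F \<ge> 0\<close> \<open>G > 0\<close> \<open>D \<ge> 0\<close> by (intro theta_const_le) auto
    have \<theta>_nonneg: "\<theta> \<ge> 0"
      unfolding \<theta>_def theta_const_def delta_const_def
      using \<open>F \<ge> 0\<close> \<open>G > 0\<close> \<open>D \<ge> 0\<close> by (intro max.coboundedI1) simp
    have "\<theta> * real V / real T \<le> \<Theta> * real V / (real V)\<^sup>2"
    proof (rule frac_le)
      show "(real V)\<^sup>2 \<le> real T" using T by (metis of_nat_le_iff of_nat_power)
      show "0 \<le> \<Theta> * real V" using \<theta>_le \<theta>_nonneg by simp
    qed (use \<theta>_le V in \<open>auto intro: mult_right_mono\<close>)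
    also have "\<dots> = \<Theta> / real V" using V by (simp add: power2_eq_square)
    finally have 1: "\<theta> * real V / real T \<le> \<Theta> / real V" .
    have 2: "G\<^sup>2 * (1 + \<theta> * sqrt (real k))\<^sup>2 / (4 * real V)
        \<le> G\<^sup>2 * (1 + \<Theta> * sqrt (real k))\<^sup>2 / (4 * real V)"
      using \<theta>_le \<theta>_nonneg
      by (intro divide_right_mono mult_left_mono power_mono add_left_mono mult_right_mono) auto
    have "c / real V
        = \<Theta> / real V + G\<^sup>2 / (4 * real V) + G\<^sup>2 * (1 + \<Theta> * sqrt (real k))\<^sup>2 / (4 * real V)"
      by (simp add: c_def add_divide_distrib)
    thus ?thesis using bound[OF V r i T_pos \<theta>_def] 1 2 by linarith
  qed
  thus "\<exists>c::real. \<forall>V::nat. V > 0 \<longrightarrow>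
            (\<forall>X Q. online_run \<X> k f' g g' (real V) ((real V)\<^sup>2) x0 X Q \<longrightarrow>
              (\<forall>i\<in>{1..k}. \<forall>T::nat. T \<ge> V\<^sup>2 \<longrightarrow>
                 1 / real T * (\<Sum>t=0..T-1. g t i (X t)) \<le> c / real V))"
    by blast
qed

end
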